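(* Let $\mathcal P$ be a proof system with finite rule set $R$ and maximum rule arity $k$ (each rule has at most $k$ premises), where $|R|$ and $k$ are constants independent of the premise base size. For any derivation trace $\pi$ of length $n:=|\pi|$ from a premise base $B$ with $m=|B|$, there exists an encoding $\mathrm{enc}(\pi)$ satisfying $$|\mathrm{enc}(\pi)|\le k\,n\log(m+n+1)+O(n)+O(\log(m+n+1)),$$ where the $O(n)$ term is linear in $n$ with a constant depending only on $|R|$ and $k$.
   Context: $\log=\log_2$. $\mathcal P$ is an effective proof system (decidable proof checking) for a fixed logic. A premise base is a finite effectively listable set of formulas $B$ with canonical computable encoding $\langle B\rangle$ (e.g. a length-prefixed list in a fixed order). A derivation trace of $q$ from $B$ is $\pi=((r_1,\vec p_1),\dots,(r_\ell,\vec p_\ell);o)$ with $r_i\in R$ rule identifiers, $\vec p_i$ vectors of premise pointers (indices), $o$ an output pointer, such that the following replay outputs $q$: $P_0$ is the ordered list of the $m$ elements of $B$ in the canonical order; at step $i$ rule $r_i$ is applied to the formulas of the pool $P_{i-1}$ indexed by $\vec p_i$ (in the prescribed order), and its conclusion is appended to give $P_i$; the output is the formula at index $o$ of $P_\ell$. Its length is $|\pi|=\ell$. An encoding of traces means a self-delimiting binary description from which the trace can be recovered by a fixed algorithm. *)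

theory Defs
  imports Complex_Main "HOL-Library.Nat_Bijection" "HOL-Library.Sublist"
begin

text \<open>Algorithms are programs for partial recursive functions, run on lists of numbers. The value
  \<^const>\<open>None\<close> means divergence (or a missing argument).\<close>

datatype recf =
    Zero
  | Succ
  | Proj nat
  | Comp recf "recf list"
  | PrimRec recf recf
  | Mu recf

fun rec_run :: "recf \<Rightarrow> nat list \<Rightarrow> nat option" where
  "rec_run Zero xs = Some 0"
| "rec_run Succ xs = (case xs of [] \<Rightarrow> None | x # _ \<Rightarrow> Some (Suc x))"
| "rec_run (Proj i) xs = (if i < length xs then Some (xs ! i) else None)"
| "rec_run (Comp f gs) xs =
     (if \<forall>g\<in>set gs. rec_run g xs \<noteq> None
      then rec_run f (map (\<lambda>g. the (rec_run g xs)) gs) else None)"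
| "rec_run (PrimRec f g) xs =
     (case xs of [] \<Rightarrow> None
      | n # ys \<Rightarrow>
          rec_nat (rec_run f ys) (\<lambda>i r. Option.bind r (\<lambda>y. rec_run g (i # y # ys))) n)"
| "rec_run (Mu f) xs =
     (if \<exists>n. rec_run f (n # xs) = Some 0 \<and> (\<forall>i<n. rec_run f (i # xs) \<noteq> None)
      then Some (LEAST n. rec_run f (n # xs) = Some 0) else None)"

definition decidable_set :: "nat set \<Rightarrow> bool" where
  "decidable_set S \<longleftrightarrow> (\<exists>f. \<forall>x. rec_run f [x] = Some (of_bool (x \<in> S)))"

text \<open>Formulas are identified with their Goedel numbers. The field \<open>canon\<close> lists a finite set of
  formulas in the canonical order. \<open>concl P r ps\<close> is the conclusion of rule \<open>r\<close> for the ordered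
  premises \<open>ps\<close>, and \<^const>\<open>None\<close> if the rule is not applicable to them.\<close>

type_synonym formula = nat
type_synonym rule_id = nat

record proof_system =
  formulas :: "formula set"
  canon :: "formula set \<Rightarrow> formula list"
  rules :: "rule_id set"
  arity :: "rule_id \<Rightarrow> nat"
  concl :: "rule_id \<Rightarrow> formula list \<Rightarrow> formula option"

definition premise_base :: "proof_system \<Rightarrow> formula set \<Rightarrow> bool" where
  "premise_base P B \<longleftrightarrow> finite B \<and> B \<subseteq> formulas P"

text \<open>The computability of \<open>canon\<close> is stated for inputs given by an arbitrary listing \<open>xs\<close> of the
  premise base.\<close>

definition canonical_listing :: "proof_system \<Rightarrow> bool" where
  "canonical_listing P \<longleftrightarrow>
     (\<forall>B. premise_base P B \<longrightarrow> set (canon P B) = B \<and> distinct (canon P B)) \<and>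
     (\<exists>f. \<forall>xs. set xs \<subseteq> formulas P \<longrightarrow>
        rec_run f [list_encode xs] = Some (list_encode (canon P (set xs))))"

definition effective_proof_system :: "proof_system \<Rightarrow> bool" where
  "effective_proof_system P \<longleftrightarrow>
     decidable_set (formulas P) \<and>
     canonical_listing P \<and>
     (\<forall>r\<in>rules P. \<forall>ps c. concl P r ps = Some c \<longrightarrow>
        length ps = arity P r \<and> set ps \<subseteq> formulas P \<and> c \<in> formulas P) \<and>
     decidable_set {prod_encode (r, prod_encode (list_encode ps, c)) | r ps c.
        r \<in> rules P \<and> concl P r ps = Some c}"

text \<open>A trace is its list of steps (rule, premise pointers) with the output pointer; pointers are
  0-based positions in the pool.\<close>

type_synonym trace = "(rule_id \<times> nat list) list \<times> nat"

definition trace_length :: "trace \<Rightarrow> nat" where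
  "trace_length \<pi> = length (fst \<pi>)"

fun apply_step :: "proof_system \<Rightarrow> rule_id \<times> nat list \<Rightarrow> formula list \<Rightarrow> formula list option" where
  "apply_step P (r, ps) pool =
     (if r \<in> rules P \<and> (\<forall>p\<in>set ps. p < length pool)
      then map_option (\<lambda>c. pool @ [c]) (concl P r (map (\<lambda>p. pool ! p) ps))
      else None)"

fun run_steps ::
  "proof_system \<Rightarrow> (rule_id \<times> nat list) list \<Rightarrow> formula list \<Rightarrow> formula list option" where
  "run_steps P [] pool = Some pool"
| "run_steps P (s # ss) pool = Option.bind (apply_step P s pool) (run_steps P ss)"

definition replay :: "proof_system \<Rightarrow> formula set \<Rightarrow> trace \<Rightarrow> formula option" where
  "replay P B \<pi> = Option.bind (run_steps P (fst \<pi>) (canon P B))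
     (\<lambda>pool. if snd \<pi> < length pool then Some (pool ! snd \<pi>) else None)"

definition derivation_trace :: "proof_system \<Rightarrow> formula set \<Rightarrow> formula \<Rightarrow> trace \<Rightarrow> bool" where
  "derivation_trace P B q \<pi> \<longleftrightarrow> premise_base P B \<and> replay P B \<pi> = Some q"

definition bits_code :: "bool list \<Rightarrow> nat" where
  "bits_code w = list_encode (map of_bool w)"

definition trace_code :: "trace \<Rightarrow> nat" where
  "trace_code \<pi> = prod_encode
     (list_encode (map (\<lambda>(r, ps). prod_encode (r, list_encode ps)) (fst \<pi>)), snd \<pi>)"

definition computable_decoder :: "(bool list \<Rightarrow> trace option) \<Rightarrow> bool" where
  "computable_decoder dec \<longleftrightarrow>
     (\<exists>f. \<forall>w. rec_run f [bits_code w] = map_option trace_code (dec w))"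

definition self_delimiting :: "(bool list \<Rightarrow> trace option) \<Rightarrow> bool" where
  "self_delimiting dec \<longleftrightarrow>
     (\<forall>v w. dec v \<noteq> None \<and> dec w \<noteq> None \<and> prefix v w \<longrightarrow> v = w)"

text \<open>The decoder sees only the code word: neither the premise base nor its size is supplied.\<close>

definition trace_encoding ::
  "proof_system \<Rightarrow> (trace \<Rightarrow> bool list) \<Rightarrow> bool" where
  "trace_encoding P enc \<longleftrightarrow>
     (\<exists>dec. computable_decoder dec \<and> self_delimiting dec \<and>
        (\<forall>B q \<pi>. derivation_trace P B q \<pi> \<longrightarrow> dec (enc \<pi>) = Some \<pi>))"

end

(* The code of a trace is: a width v in unary, the output pointer as a block of v + 1 binary digits,
   and the list of steps, each a rule index in unary followed by the list of its pointers as blocks.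
   Lists are delimited by a continuation digit before every entry.  The leading digit of a block is
   left unreduced, so that without any side condition this is a prefix code over the alphabet of all
   natural numbers, and a pointer fits into its block iff the block is binary.  Hence the decoder may
   simply search for a pair of a width and a trace whose code is the given word: only the encoder
   has to be shown computable, and self-delimitation is cancellation in the prefix code. *)

theory Submission
  imports Defs
begin

section \<open>Total recursive functions\<close>

text \<open>The variables of a term are the entries \<open>xs ! i\<close> of the argument list, so
  that the closure lemmas can take a lambda term apart syntactically.\<close>

definition computable :: "nat \<Rightarrow> (nat list \<Rightarrow> nat) \<Rightarrow> bool" where
  "computable n F \<longleftrightarrow> (\<exists>f. \<forall>xs. length xs = n \<longrightarrow> rec_run f xs = Some (F xs))"

lemma computable_cong:
  assumes "computable n F" and "\<And>xs. length xs = n \<Longrightarrow> F xs = G xs"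
  shows "computable n G"
  using assms unfolding computable_def by metis

lemma computable_comp:
  assumes F: "computable (length Gs) F" and Gs: "\<And>G. G \<in> set Gs \<Longrightarrow> computable n G"
  shows "computable n (\<lambda>xs. F (map (\<lambda>G. G xs) Gs))"
proof -
  obtain f where f: "\<And>xs. length xs = length Gs \<Longrightarrow> rec_run f xs = Some (F xs)"
    using F unfolding computable_def by blast
  have "\<forall>G\<in>set Gs. \<exists>g. \<forall>xs. length xs = n \<longrightarrow> rec_run g xs = Some (G xs)"
    using Gs unfolding computable_def by blast
  then obtain p where p: "\<And>G xs. G \<in> set Gs \<Longrightarrow> length xs = n \<Longrightarrow> rec_run (p G) xs = Some (G xs)"
    by metis
  have "rec_run (Comp f (map p Gs)) xs = Some (F (map (\<lambda>G. G xs) Gs))" if "length xs = n" for xs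
  proof -
    have "map (\<lambda>g. the (rec_run g xs)) (map p Gs) = map (\<lambda>G. G xs) Gs"
      using p that by simp
    then show ?thesis using p that f by (simp del: map_map)
  qed
  then show ?thesis unfolding computable_def by blast
qed

text \<open>Lifts a function shown computable at its own arity to computable arguments in any number
  of variables; this is the form that backward reasoning with \<open>intro\<close> can
  match.\<close>

lemma computable_comp1:
  assumes "computable 1 (\<lambda>xs. f (xs ! 0))" "computable n g"
  shows "computable n (\<lambda>xs. f (g xs))"
  using computable_comp[of "[g]" "\<lambda>xs. f (xs ! 0)" n] assms by simp

lemma computable_comp2:
  assumes "computable 2 (\<lambda>xs. f (xs ! 0) (xs ! 1))" "computable n g" "computable n h"
  shows "computable n (\<lambda>xs. f (g xs) (h xs))"
  using computable_comp[of "[g, h]" "\<lambda>xs. f (xs ! 0) (xs ! 1)" n] assms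
  by (auto simp: numeral_2_eq_2)

lemma computable_proj: "i < n \<Longrightarrow> computable n (\<lambda>xs. xs ! i)"
  unfolding computable_def by (rule exI[of _ "Proj i"]) simp

text \<open>Recursion and minimisation pass the parameters on as \<open>drop k ys\<close>, behind
  the bound variables; this rule reads them there.\<close>

lemma computable_drop_proj: "k + i < n \<Longrightarrow> computable n (\<lambda>xs. drop k xs ! i)"
  by (rule computable_cong[OF computable_proj[of "k + i"]]) auto

lemma computable_Suc: "computable n g \<Longrightarrow> computable n (\<lambda>xs. Suc (g xs))"
  by (rule computable_comp1[where f = Suc])
    (auto simp: computable_def length_Suc_conv intro!: exI[of _ Succ])

lemma computable_const: "computable n (\<lambda>_. c)"
proof (induction c)
  case 0
  show ?case unfolding computable_def by (rule exI[of _ Zero]) simp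
next
  case (Suc c)
  then show ?case by (rule computable_Suc)
qed

lemma computable_rec:
  assumes a: "computable n a" and m: "computable n m"
    and s: "computable (Suc (Suc n)) (\<lambda>ys. s (ys ! 0) (ys ! 1) (drop 2 ys))"
  shows "computable n (\<lambda>xs. rec_nat (a xs) (\<lambda>i r. s i r xs) (m xs))"
proof -
  obtain f g where f: "\<And>xs. length xs = n \<Longrightarrow> rec_run f xs = Some (a xs)"
    and g: "\<And>ys. length ys = Suc (Suc n) \<Longrightarrow>
      rec_run g ys = Some (s (ys ! 0) (ys ! 1) (drop 2 ys))"
    using a s unfolding computable_def by blast
  have run: "rec_run (PrimRec f g) (j # xs) = Some (rec_nat (a xs) (\<lambda>i r. s i r xs) j)"
    if "length xs = n" for j xs
    by (induction j) (use that f g in \<open>auto simp: numeral_2_eq_2\<close>)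
  \<comment> \<open>\<open>PrimRec\<close> recurses on its first argument, so the bound of the
    recursion is at first a separate variable in front of the parameters.\<close>
  have "computable (Suc n) (\<lambda>ys. rec_nat (a (tl ys)) (\<lambda>i r. s i r (tl ys)) (hd ys))"
    unfolding computable_def
  proof (intro exI[of _ "PrimRec f g"] allI impI)
    fix ys :: "nat list"
    assume "length ys = Suc n"
    then obtain j xs where "ys = j # xs" "length xs = n" by (auto simp: length_Suc_conv)
    then show "rec_run (PrimRec f g) ys =
        Some (rec_nat (a (tl ys)) (\<lambda>i r. s i r (tl ys)) (hd ys))"
      using run[of xs j] by (simp del: rec_run.simps)
  qed
  \<comment> \<open>Substitute \<open>m\<close> for that variable and the projections for the
    parameters.\<close>
  then have "computable n (\<lambda>xs. (\<lambda>ys. rec_nat (a (tl ys)) (\<lambda>i r. s i r (tl ys)) (hd ys))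
      (map (\<lambda>G. G xs) (m # map (\<lambda>i xs. xs ! i) [0..<n])))"
    by (intro computable_comp) (auto intro: m computable_proj)
  then show ?thesis
  proof (rule computable_cong)
    fix xs :: "nat list"
    assume "length xs = n"
    then have "map (\<lambda>G. G xs) (map (\<lambda>i xs. xs ! i) [0..<n]) = xs"
      using map_nth[of xs] by (simp add: comp_def)
    then show "(\<lambda>ys. rec_nat (a (tl ys)) (\<lambda>i r. s i r (tl ys)) (hd ys))
      (map (\<lambda>G. G xs) (m # map (\<lambda>i xs. xs ! i) [0..<n])) = rec_nat (a xs) (\<lambda>i r. s i r xs) (m xs)"
      by (simp del: map_map)
  qed
qed

section \<open>Arithmetic, case distinction and minimisation\<close>

lemma computable_add:
  assumes "computable n f" "computable n g"
  shows "computable n (\<lambda>xs. f xs + g xs)"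
proof -
  have eq: "a + b = rec_nat b (\<lambda>i r. Suc r) a" for a b :: nat
    by (induction a) simp_all
  show ?thesis unfolding eq
    by (intro computable_rec assms computable_Suc computable_proj) simp
qed

lemma computable_mult:
  assumes "computable n f" "computable n g"
  shows "computable n (\<lambda>xs. f xs * g xs)"
proof (rule computable_comp2[OF _ assms])
  have eq: "a * b = rec_nat 0 (\<lambda>i r. r + b) a" for a b :: nat
    by (induction a) simp_all
  show "computable 2 (\<lambda>xs. xs ! 0 * xs ! 1)" unfolding eq
    by (intro computable_rec computable_add computable_proj computable_drop_proj computable_const)
      simp_all
qed

lemma computable_power:
  assumes "computable n f" "computable n g"
  shows "computable n (\<lambda>xs. f xs ^ g xs)"
proof (rule computable_comp2[OF _ assms])
  have eq: "a ^ b = rec_nat 1 (\<lambda>i r. r * a) b" for a b :: nat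
    by (induction b) simp_all
  show "computable 2 (\<lambda>xs. xs ! 0 ^ xs ! 1)" unfolding eq
    by (intro computable_rec computable_mult computable_proj computable_drop_proj computable_const)
      simp_all
qed

lemma computable_pred:
  assumes "computable n f"
  shows "computable n (\<lambda>xs. f xs - 1)"
proof -
  \<comment> \<open>The last value of the recursion counter is the predecessor; the start value 0
    serves for \<open>a = 0\<close>.\<close>
  have eq: "a - 1 = rec_nat 0 (\<lambda>i r. i) a" for a :: nat
    by (cases a) simp_all
  show ?thesis unfolding eq
    by (intro computable_rec assms computable_const computable_proj) simp
qed

lemma computable_diff:
  assumes "computable n f" "computable n g"
  shows "computable n (\<lambda>xs. f xs - g xs)"
proof -
  have eq: "a - b = rec_nat a (\<lambda>i r. r - 1) b" for a b :: nat
    by (induction b) simp_all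
  have "computable n (\<lambda>xs. rec_nat (f xs) (\<lambda>i r. r - 1) (g xs))"
    by (intro computable_rec computable_pred assms computable_proj) simp
  then show ?thesis unfolding eq[symmetric] .
qed

lemma computable_if_eq:
  assumes "computable n f" "computable n g" "computable n a" "computable n b"
  shows "computable n (\<lambda>xs. if f xs = g xs then a xs else b xs)"
proof -
  \<comment> \<open>The two truncated differences add up to the distance of \<open>f xs\<close> and
    \<open>g xs\<close>; subtracting it from 1 gives the indicator of equality, and doing so twice
    gives that of inequality.\<close>
  have eq: "(if f xs = g xs then a xs else b xs) =
      a xs * (1 - ((f xs - g xs) + (g xs - f xs))) + b xs * (1 - (1 - ((f xs - g xs) + (g xs - f xs))))"
    for xs by auto
  show ?thesis unfolding eq
    by (intro computable_add computable_mult computable_diff computable_const assms)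
qed

text \<open>\<open>Mu\<close> also wants all earlier values to be defined; a total \<open>p\<close>
  guarantees this, so a zero for every input makes the search total.\<close>

lemma computable_Least:
  assumes p: "computable (Suc n) (\<lambda>ys. p (ys ! 0) (drop 1 ys))"
    and ex: "\<And>xs. length xs = n \<Longrightarrow> \<exists>y. p y xs = 0"
  shows "computable n (\<lambda>xs. LEAST y. p y xs = 0)"
proof -
  obtain f where f: "\<And>ys. length ys = Suc n \<Longrightarrow> rec_run f ys = Some (p (ys ! 0) (drop 1 ys))"
    using p unfolding computable_def by blast
  have "rec_run (Mu f) xs = Some (LEAST y. p y xs = 0)" if "length xs = n" for xs
    using ex[OF that] f[of "_ # xs"] that by simp
  then show ?thesis unfolding computable_def by blast
qed

text \<open>On a finite set an arbitrary \<open>f\<close> is a table: every element costs one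
  equality test against a constant and one constant value.\<close>

lemma computable_finite_cases:
  assumes "finite A" "computable 1 (\<lambda>xs. g (xs ! 0))"
  shows "computable 1 (\<lambda>xs. if xs ! 0 \<in> A then f (xs ! 0) else g (xs ! 0))"
  using assms(1)
proof induction
  case empty
  then show ?case using assms(2) by simp
next
  case (insert a A)
  have eq: "(if x \<in> insert a A then f x else g x) = (if x = a then f a else if x \<in> A then f x else g x)"
    for x by auto
  show ?case unfolding eq
    by (intro computable_if_eq computable_const computable_proj insert.IH) simp
qed

section \<open>Pairs and lists of natural numbers\<close>

definition pfst :: "nat \<Rightarrow> nat" where "pfst z = fst (prod_decode z)"
definition psnd :: "nat \<Rightarrow> nat" where "psnd z = snd (prod_decode z)"

lemma pfst_prod_encode [simp]: "pfst (prod_encode (a, b)) = a"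
  and psnd_prod_encode [simp]: "psnd (prod_encode (a, b)) = b"
  by (simp_all add: pfst_def psnd_def)

lemma prod_encode_pfst_psnd: "prod_encode (pfst z, psnd z) = z"
  by (simp add: pfst_def psnd_def)

section \<open>Inverting the Cantor pairing\<close>

lemma computable_triangle:
  assumes "computable n f"
  shows "computable n (\<lambda>xs. triangle (f xs))"
proof -
  have eq: "triangle a = rec_nat 0 (\<lambda>i r. r + Suc i) a" for a
    by (induction a) simp_all
  show ?thesis unfolding eq
    by (intro computable_rec computable_add computable_Suc computable_const computable_proj assms)
      simp_all
qed

lemma computable_prod_encode:
  assumes "computable n f" "computable n g"
  shows "computable n (\<lambda>xs. prod_encode (f xs, g xs))"
  unfolding prod_encode_def by (simp, intro computable_add computable_triangle assms)

lemma mono_triangle: "mono triangle"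
  by (simp add: mono_iff_le_Suc)

text \<open>The index of the Cantor diagonal that contains \<open>z\<close>: the condition says
  \<open>z < triangle (Suc s)\<close>, phrased as a zero so that minimisation applies.\<close>

definition diagonal :: "nat \<Rightarrow> nat" where
  "diagonal z = (LEAST s. Suc z - triangle (Suc s) = 0)"

text \<open>The code of \<open>(a, b)\<close> is \<open>triangle (a + b) + a\<close> with
  \<open>a \<le> a + b\<close>, so it lies between the triangle numbers of \<open>a + b\<close> and
  of \<open>Suc (a + b)\<close>.\<close>

lemma diagonal_eq: "diagonal z = pfst z + psnd z"
  unfolding diagonal_def
proof (rule Least_equality)
  have z: "z = triangle (pfst z + psnd z) + pfst z"
    using prod_encode_pfst_psnd[of z] by (simp add: prod_encode_def)
  then show "Suc z - triangle (Suc (pfst z + psnd z)) = 0" by simp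
  fix s
  assume "Suc z - triangle (Suc s) = 0"
  then have "triangle (pfst z + psnd z) < triangle (Suc s)" using z by linarith
  then show "pfst z + psnd z \<le> s"
    using mono_triangle by (metis monoD not_less_eq_eq not_less)
qed

lemma computable_diagonal:
  assumes "computable n f"
  shows "computable n (\<lambda>xs. diagonal (f xs))"
proof (rule computable_comp1[OF _ assms])
  have ex: "\<exists>s. Suc z - triangle (Suc s) = 0" for z
    by (rule exI[of _ z]) simp
  show "computable 1 (\<lambda>xs. diagonal (xs ! 0))"
    unfolding diagonal_def
    by (intro computable_Least computable_diff computable_triangle computable_Suc computable_proj
        computable_drop_proj ex) simp_all
qed

lemma computable_pfst:
  assumes "computable n f"
  shows "computable n (\<lambda>xs. pfst (f xs))"
proof -
  have eq: "pfst z = z - triangle (diagonal z)" for z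
    using prod_encode_pfst_psnd[of z] by (simp add: prod_encode_def diagonal_eq)
  show ?thesis unfolding eq
    by (intro computable_diff computable_triangle computable_diagonal assms)
qed

lemma computable_psnd:
  assumes "computable n f"
  shows "computable n (\<lambda>xs. psnd (f xs))"
proof -
  have eq: "psnd z = diagonal z - pfst z" for z
    by (simp add: diagonal_eq)
  show ?thesis unfolding eq
    by (intro computable_diff computable_diagonal computable_pfst assms)
qed

section \<open>Operations on list codes\<close>

lemma computable_Cons:
  assumes "computable n f" "computable n (\<lambda>xs. list_encode (g xs))"
  shows "computable n (\<lambda>xs. list_encode (f xs # g xs))"
  by (simp, intro computable_Suc computable_prod_encode assms)

text \<open>A nonempty list is coded as the successor of the pair of head and coded tail, so
  predecessor and second projection yield the tail.\<close>

definition drop_code :: "nat \<Rightarrow> nat \<Rightarrow> nat" where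
  "drop_code i z = rec_nat z (\<lambda>_ r. psnd (r - 1)) i"

lemma drop_code_eq: "drop_code i z = list_encode (drop i (list_decode z))"
proof (induction i)
  case 0
  show ?case by (simp add: drop_code_def)
next
  case (Suc i)
  have "psnd (list_encode ys - 1) = list_encode (tl ys)" for ys
  proof (cases ys)
    case Nil
    \<comment> \<open>The empty list has code 0 and is its own tail, because
      \<open>0 - 1 = 0\<close> and 0 codes the pair \<open>(0, 0)\<close>.\<close>
    then show ?thesis using psnd_prod_encode[of 0 0] by (simp add: prod_encode_def)
  qed simp
  then show ?case using Suc by (simp add: drop_code_def drop_Suc tl_drop)
qed

lemma computable_drop_code:
  assumes "computable n f" "computable n g"
  shows "computable n (\<lambda>xs. drop_code (f xs) (g xs))"
  unfolding drop_code_def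
  by (intro computable_rec computable_psnd computable_pred computable_proj assms) simp_all

lemma computable_length:
  assumes "computable n f"
  shows "computable n (\<lambda>xs. length (list_decode (f xs)))"
proof (rule computable_comp1[OF _ assms])
  have code0: "drop_code i z = 0 \<longleftrightarrow> length (list_decode z) \<le> i" for i z
    using list_encode_eq[of "drop i (list_decode z)" "[]"] by (simp add: drop_code_eq del: list_encode_eq)
  have eq: "length (list_decode z) = (LEAST i. drop_code i z = 0)" for z
    by (rule Least_equality[symmetric]) (simp_all add: code0)
  show "computable 1 (\<lambda>xs. length (list_decode (xs ! 0)))"
    unfolding eq
    by (intro computable_Least computable_drop_code computable_proj computable_drop_proj)
      (auto simp: code0)
qed

text \<open>A right fold consumes the list from its end, so it becomes a primitive recursion over
  the length whose counter is translated into an index from the right.\<close>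

lemma computable_foldr:
  assumes l: "computable n (\<lambda>xs. list_encode (l xs))" and a: "computable n a"
    and s: "computable (Suc (Suc n)) (\<lambda>ys. s (ys ! 0) (ys ! 1) (drop 2 ys))"
  shows "computable n (\<lambda>xs. foldr (\<lambda>x r. s x r xs) (l xs) (a xs))"
proof -
  define nth_code where "nth_code z i = pfst (drop_code i z - 1)" for z i
  define len where "len z = length (list_decode z)" for z
  have nth_code: "nth_code (list_encode ys) i = ys ! i" if "i < length ys" for ys i
    using Cons_nth_drop_Suc[OF that, symmetric] by (simp add: nth_code_def drop_code_eq)
  \<comment> \<open>After \<open>j\<close> rounds exactly the last \<open>j\<close> entries have
    been folded.\<close>
  have prefix_rec: "rec_nat b (\<lambda>i r. f (nth_code (list_encode ys) (length ys - Suc i)) r) j =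
      foldr f (drop (length ys - j) ys) b" if "j \<le> length ys" for f :: "nat \<Rightarrow> nat \<Rightarrow> nat" and b ys j
    using that
  proof (induction j)
    case (Suc j)
    then have "drop (length ys - Suc j) ys = ys ! (length ys - Suc j) # drop (length ys - j) ys"
      using Cons_nth_drop_Suc[of "length ys - Suc j" ys] by (simp add: Suc_diff_Suc)
    then show ?case using Suc by (simp add: nth_code)
  qed simp
  have eq: "foldr f ys b = rec_nat b
      (\<lambda>i r. f (nth_code (list_encode ys) (len (list_encode ys) - Suc i)) r) (len (list_encode ys))"
    for f :: "nat \<Rightarrow> nat \<Rightarrow> nat" and ys b
    using prefix_rec[of "length ys"] by (simp add: len_def)
  \<comment> \<open>The list depends on the parameters alone; inside the recursion, counter and
    accumulator stand in front of them.\<close>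
  have weaken: "computable (Suc (Suc n)) (\<lambda>ys. g (drop 2 ys))" if "computable n g" for g
  proof -
    have "computable (Suc (Suc n)) (\<lambda>ys. g (map (\<lambda>G. G ys) (map (\<lambda>i ys. ys ! (2 + i)) [0..<n])))"
      by (rule computable_comp) (use that in \<open>auto intro: computable_proj\<close>)
    then show ?thesis
      by (rule computable_cong) (auto intro!: arg_cong[of _ _ g] nth_equalityI)
  qed
  \<comment> \<open>The fold step expects a list entry where the recursion supplies its counter, so
    the first argument is replaced by a computed one.\<close>
  have step: "computable (Suc (Suc n)) (\<lambda>ys. s (g ys) (ys ! 1) (drop 2 ys))"
    if g: "computable (Suc (Suc n)) g" for g
  proof -
    have "computable (Suc (Suc n)) (\<lambda>ys. (\<lambda>ys. s (ys ! 0) (ys ! 1) (drop 2 ys))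
        (map (\<lambda>G. G ys) (g # map (\<lambda>i ys. ys ! Suc i) [0..<Suc n])))"
      by (rule computable_comp) (use s g in \<open>auto intro: computable_proj\<close>)
    then show ?thesis
    proof (rule computable_cong)
      fix ys :: "nat list"
      assume len: "length ys = Suc (Suc n)"
      have "map (\<lambda>G. G ys) (map (\<lambda>i ys. ys ! Suc i) [0..<Suc n]) = drop 1 ys"
        by (rule nth_equalityI) (use len in \<open>auto simp del: upt_Suc\<close>)
      then have "map (\<lambda>G. G ys) (g # map (\<lambda>i ys. ys ! Suc i) [0..<Suc n]) = g ys # drop 1 ys"
        by simp
      then show "(\<lambda>ys. s (ys ! 0) (ys ! 1) (drop 2 ys))
          (map (\<lambda>G. G ys) (g # map (\<lambda>i ys. ys ! Suc i) [0..<Suc n])) = s (g ys) (ys ! 1) (drop 2 ys)"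
        using len by (simp add: nth_Cons' numeral_2_eq_2 del: upt_Suc)
    qed
  qed
  have len: "computable k (\<lambda>xs. len (f xs))" if "computable k f" for k f
    unfolding len_def by (rule computable_length[OF that])
  show ?thesis unfolding eq
    by (rule computable_rec[OF a len[OF l]], rule step, unfold nth_code_def)
      (intro computable_pfst computable_pred computable_drop_code computable_diff computable_Suc
        computable_proj len weaken[OF l], simp)
qed

lemma computable_append:
  assumes "computable n (\<lambda>xs. list_encode (f xs))" "computable n (\<lambda>xs. list_encode (g xs))"
  shows "computable n (\<lambda>xs. list_encode (f xs @ g xs))"
proof -
  have eq: "list_encode (a @ b) = foldr (\<lambda>x r. Suc (prod_encode (x, r))) a (list_encode b)" for a b
    by (induction a) simp_all
  show ?thesis unfolding eq
    by (intro computable_foldr computable_Suc computable_prod_encode computable_proj assms) simp_all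
qed

section \<open>A prefix code for traces\<close>

text \<open>Cancellation before arbitrary continuations combines injectivity with prefix-freeness,
  and lets a concatenation be parsed component by component from the left.\<close>

definition prefix_code :: "('a \<Rightarrow> 'b list) \<Rightarrow> bool" where
  "prefix_code f \<longleftrightarrow> (\<forall>x y a b. f x @ a = f y @ b \<longrightarrow> x = y \<and> a = b)"

lemma prefix_codeD: "prefix_code f \<Longrightarrow> f x @ a = f y @ b \<Longrightarrow> x = y \<and> a = b"
  unfolding prefix_code_def by blast

definition unary :: "nat \<Rightarrow> nat list" where
  "unary v = replicate v 1 @ [0]"

fun low_digits :: "nat \<Rightarrow> nat \<Rightarrow> nat list" where
  "low_digits 0 x = []"
| "low_digits (Suc v) x = (x div 2 ^ v) mod 2 # low_digits v x"

definition block :: "nat \<Rightarrow> nat \<Rightarrow> nat list" where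
  "block v x = x div 2 ^ v # low_digits v x"

definition list_code :: "('a \<Rightarrow> nat list) \<Rightarrow> 'a list \<Rightarrow> nat list" where
  "list_code f xs = foldr (\<lambda>x r. 1 # f x @ r) xs [0]"

lemma list_code_simps [simp]:
  "list_code f [] = [0]" "list_code f (x # xs) = 1 # f x @ list_code f xs"
  by (simp_all add: list_code_def)

definition step_code :: "(nat \<Rightarrow> nat) \<Rightarrow> nat \<Rightarrow> nat \<Rightarrow> nat list" where
  "step_code idx v z = unary (idx (pfst z)) @ list_code (block v) (list_decode (psnd z))"

text \<open>Here \<open>s\<close> codes the width paired with a trace code, that is, with the pair
  of the coded step list and the output pointer. Working on codes makes the encoder a function of a
  single number.\<close>

definition digits :: "(nat \<Rightarrow> nat) \<Rightarrow> nat \<Rightarrow> nat list" where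
  "digits idx s = unary (pfst s) @ block (pfst s) (psnd (psnd s)) @
     list_code (step_code idx (pfst s)) (list_decode (pfst (psnd s)))"

section \<open>Unique parsing\<close>

lemma prefix_code_unary: "prefix_code unary"
proof -
  have "x = y \<and> a = b" if "unary x @ a = unary y @ b" for x y a b
    using that
  proof (induction x arbitrary: y)
    case 0
    then show ?case by (cases y) (auto simp: unary_def)
  next
    case (Suc x)
    then show ?case by (cases y) (auto simp: unary_def)
  qed
  then show ?thesis unfolding prefix_code_def by blast
qed

lemma low_digits_inject:
  "x div 2 ^ v = y div 2 ^ v \<Longrightarrow> low_digits v x = low_digits v y \<Longrightarrow> x = y"
proof (induction v)
  case (Suc v)
  \<comment> \<open>The quotient by \<open>2 ^ Suc v\<close> and the first digit are quotient and
    remainder of \<open>x div 2 ^ v\<close> modulo 2, and so determine it.\<close>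
  have "x div 2 ^ v = y div 2 ^ v"
    using Suc.prems by (metis div_mult2_eq div_mod_decomp list.inject low_digits.simps(2) power_Suc2)
  then show ?case using Suc by simp
qed simp

lemma length_low_digits [simp]: "length (low_digits v x) = v"
  by (induction v) simp_all

lemma length_block [simp]: "length (block v x) = Suc v"
  by (simp add: block_def)

lemma prefix_code_block: "prefix_code (block v)"
  unfolding prefix_code_def
proof (intro allI impI)
  fix x y and a b :: "nat list"
  assume "block v x @ a = block v y @ b"
  then have "block v x = block v y" "a = b" by (simp_all add: append_eq_append_conv)
  then show "x = y \<and> a = b" using low_digits_inject[of x v y] by (simp add: block_def)
qed

text \<open>The continuation digit tells on both sides alike whether another entry follows; each
  entry is then cancelled by the prefix code \<open>f\<close>.\<close>

lemma prefix_code_list_code: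
  assumes "prefix_code f"
  shows "prefix_code (list_code f)"
proof -
  have "x = y \<and> a = b" if "list_code f x @ a = list_code f y @ b" for x y a b
    using that
  proof (induction x arbitrary: y)
    case Nil
    then show ?case by (cases y) auto
  next
    case (Cons u x)
    then obtain w z where y: "y = w # z" by (cases y) auto
    with Cons.prems have "f u @ (list_code f x @ a) = f w @ (list_code f z @ b)" by simp
    then have "u = w" "list_code f x @ a = list_code f z @ b"
      using prefix_codeD[OF assms] by blast+
    then show ?case using Cons.IH y by blast
  qed
  then show ?thesis unfolding prefix_code_def by blast
qed

lemma prefix_code_step_code:
  assumes "inj idx"
  shows "prefix_code (step_code idx v)"
  unfolding prefix_code_def
proof (intro allI impI)
  fix x y and a b :: "nat list"
  assume "step_code idx v x @ a = step_code idx v y @ b"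
  then have *: "unary (idx (pfst x)) @ (list_code (block v) (list_decode (psnd x)) @ a) =
      unary (idx (pfst y)) @ (list_code (block v) (list_decode (psnd y)) @ b)"
    by (simp add: step_code_def)
  note 1 = prefix_codeD[OF prefix_code_unary *]
  then have 2: "list_decode (psnd x) = list_decode (psnd y) \<and> a = b"
    using prefix_codeD[OF prefix_code_list_code[OF prefix_code_block]] by blast
  have "pfst x = pfst y" using 1 by (simp add: inj_eq[OF assms])
  moreover have "psnd x = psnd y" using 2 by (metis list_decode_inverse)
  ultimately show "x = y \<and> a = b" using 2 by (metis prod_encode_pfst_psnd)
qed

lemma prefix_code_digits:
  assumes "inj idx"
  shows "prefix_code (digits idx)"
  unfolding prefix_code_def
proof (intro allI impI)
  fix x y and a b :: "nat list"
  let ?rest = "\<lambda>s a. block (pfst s) (psnd (psnd s)) @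
     (list_code (step_code idx (pfst s)) (list_decode (pfst (psnd s))) @ a)"
  assume "digits idx x @ a = digits idx y @ b"
  then have "unary (pfst x) @ ?rest x a = unary (pfst y) @ ?rest y b"
    by (simp add: digits_def)
  \<comment> \<open>The width has to be cancelled first: only with equal widths do both sides use
    the same block code for the rest.\<close>
  then have 1: "pfst x = pfst y" and *: "?rest x a = ?rest y b"
    using prefix_codeD[OF prefix_code_unary] by blast+
  have 2: "psnd (psnd x) = psnd (psnd y)" and
    **: "list_code (step_code idx (pfst x)) (list_decode (pfst (psnd x))) @ a =
      list_code (step_code idx (pfst x)) (list_decode (pfst (psnd y))) @ b"
    using prefix_codeD[OF prefix_code_block *[unfolded 1]] 1 by simp_all
  have 3: "list_decode (pfst (psnd x)) = list_decode (pfst (psnd y)) \<and> a = b"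
    using prefix_codeD[OF prefix_code_list_code[OF prefix_code_step_code[OF assms]] **] .
  then have "psnd x = psnd y"
    using 2 prod_encode_pfst_psnd by (metis list_decode_inverse)
  then show "x = y \<and> a = b" using 1 3 by (metis prod_encode_pfst_psnd)
qed

section \<open>Computability of the encoder\<close>

lemma computable_unary:
  assumes "computable n f"
  shows "computable n (\<lambda>xs. list_encode (unary (f xs)))"
proof -
  have eq: "list_encode (unary v) = rec_nat (list_encode [0]) (\<lambda>_ r. Suc (prod_encode (1, r))) v" for v
    by (induction v) (simp_all add: unary_def)
  show ?thesis unfolding eq
    by (intro computable_rec computable_Suc computable_prod_encode computable_const computable_proj
        assms) simp
qed

text \<open>The quotient is the least \<open>q\<close> with \<open>x < Suc q * 2 ^ v\<close>, found
  by minimisation.\<close>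

lemma computable_div_power2:
  assumes "computable n f" "computable n g"
  shows "computable n (\<lambda>xs. f xs div 2 ^ g xs)"
proof (rule computable_comp2[OF _ assms])
  have less: "Suc x - Suc q * 2 ^ v = 0 \<longleftrightarrow> x div 2 ^ v \<le> q" for x q v :: nat
    using less_mult_imp_div_less[of x "Suc q" "2 ^ v"] div_less_iff_less_mult[of "2 ^ v" x "Suc q"]
    by (auto simp: Suc_le_eq less_Suc_eq_le)
  have eq: "x div 2 ^ v = (LEAST q. Suc x - Suc q * 2 ^ v = 0)" for x v :: nat
    unfolding less by (rule Least_equality[symmetric]) simp_all
  have "computable 2 (\<lambda>xs. LEAST q. Suc (xs ! 0) - Suc q * 2 ^ (xs ! 1) = 0)"
    by (rule computable_Least, intro computable_diff computable_mult computable_power computable_Suc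
        computable_const computable_proj computable_drop_proj) (auto simp only: less)
  then show "computable 2 (\<lambda>xs. xs ! 0 div 2 ^ xs ! 1)" unfolding eq .
qed

lemma computable_mod2:
  assumes "computable n f"
  shows "computable n (\<lambda>xs. f xs mod 2)"
proof -
  have eq: "x mod 2 = x - 2 * (x div 2 ^ 1)" for x :: nat
    by (simp add: minus_mult_div_eq_mod)
  show ?thesis unfolding eq
    by (intro computable_diff computable_mult computable_const computable_div_power2 assms)
qed

lemma computable_block:
  assumes "computable n f" "computable n g"
  shows "computable n (\<lambda>xs. list_encode (block (f xs) (g xs)))"
proof (rule computable_comp2[OF _ assms])
  have low: "list_encode (low_digits v x) =
      rec_nat 0 (\<lambda>i r. Suc (prod_encode ((x div 2 ^ i) mod 2, r))) v" for v x
    by (induction v) simp_all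
  show "computable 2 (\<lambda>xs. list_encode (block (xs ! 0) (xs ! 1)))"
    unfolding block_def list_encode.simps low
    by (intro computable_Suc computable_prod_encode computable_rec computable_mod2
        computable_div_power2 computable_const computable_proj computable_drop_proj) simp_all
qed

lemma computable_list_code:
  assumes l: "computable n (\<lambda>xs. list_encode (l xs))" and v: "computable n v"
    and f: "computable 2 (\<lambda>xs. list_encode (f (xs ! 0) (xs ! 1)))"
  shows "computable n (\<lambda>xs. list_encode (list_code (f (v xs)) (l xs)))"
proof -
  \<comment> \<open>Decoding the accumulator and encoding it again turns the fold over digit lists
    into a fold over numbers.\<close>
  have eq: "list_encode (list_code g xs) =
      foldr (\<lambda>x r. list_encode (1 # g x @ list_decode r)) xs (list_encode [0])" for g xs
  proof (induction xs)
    case (Cons x xs)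
    have "list_encode (list_code g (x # xs)) =
        list_encode (1 # g x @ list_decode (list_encode (list_code g xs)))"
      by (simp del: list_encode.simps)
    then show ?case by (simp only: Cons) (simp del: list_encode.simps)
  qed simp
  have "computable 2 (\<lambda>ys. list_encode (list_code (f (ys ! 0)) (list_decode (ys ! 1))))"
    unfolding eq
  proof (rule computable_foldr[where s = "\<lambda>x r ys. list_encode (1 # f (ys ! 0) x @ list_decode r)"])
    show "computable (Suc (Suc 2)) (\<lambda>ys. list_encode (1 # f (drop 2 ys ! 0) (ys ! 0) @ list_decode (ys ! 1)))"
      by (intro computable_Cons computable_append computable_const computable_comp2[OF f, simplified]
          computable_drop_proj computable_proj) (simp_all add: computable_proj)
  qed (simp_all add: computable_proj computable_const del: list_encode.simps)
  from computable_comp2[OF this v l] show ?thesis by simp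
qed

lemma computable_digits:
  assumes idx: "computable 1 (\<lambda>xs. idx (xs ! 0))"
  shows "computable 1 (\<lambda>xs. list_encode (digits idx (xs ! 0)))"
proof -
  have step: "computable 2 (\<lambda>xs. list_encode (step_code idx (xs ! 0) (xs ! 1)))"
    unfolding step_code_def
    by (intro computable_append computable_unary computable_comp1[OF idx] computable_list_code
        computable_pfst computable_proj computable_block)
      (simp_all add: computable_psnd computable_proj)
  show ?thesis
    unfolding digits_def
    by (intro computable_append computable_unary computable_block computable_list_code step
        computable_pfst computable_psnd computable_proj)
      (simp_all add: computable_psnd computable_pfst computable_proj)
qed

section \<open>The decoder\<close>

text \<open>Surjectivity is what lets a search over all numbers be a search over traces: no number
  has to be rejected as ill-formed.\<close>

lemma bij_trace_code: "bij trace_code"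
proof (rule bijI)
  show "inj trace_code"
  proof (rule injI)
    fix x y
    assume "trace_code x = trace_code y"
    moreover have "inj (\<lambda>(r, ps). prod_encode (r, list_encode ps))"
      by (auto simp: inj_def list_encode_eq)
    ultimately have "fst x = fst y" "snd x = snd y"
      using list_encode_eq by (auto simp: trace_code_def inj_map_eq_map)
    then show "x = y" by (simp add: prod_eq_iff)
  qed
  show "surj trace_code"
  proof (rule surjI)
    fix t
    show "trace_code (map (\<lambda>z. (pfst z, list_decode (psnd z))) (list_decode (pfst t)), psnd t) = t"
      by (simp add: trace_code_def comp_def prod_encode_pfst_psnd)
  qed
qed

definition trace_digits :: "(nat \<Rightarrow> nat) \<Rightarrow> nat \<Rightarrow> trace \<Rightarrow> nat list" where
  "trace_digits idx v \<pi> = digits idx (prod_encode (v, trace_code \<pi>))"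

lemma trace_digits_eq:
  "trace_digits idx v (ss, j) = unary v @ block v j @
     list_code (\<lambda>(r, ps). unary (idx r) @ list_code (block v) ps) ss"
proof -
  have "list_code (step_code idx v) (map (\<lambda>(r, ps). prod_encode (r, list_encode ps)) ss) =
      list_code (\<lambda>(r, ps). unary (idx r) @ list_code (block v) ps) ss"
    by (induction ss) (auto simp: step_code_def)
  then show ?thesis
    by (simp add: trace_digits_def digits_def trace_code_def)
qed

lemma trace_digits_cancel:
  assumes "inj idx" "trace_digits idx v \<pi> @ a = trace_digits idx v' \<pi>' @ b"
  shows "v = v' \<and> \<pi> = \<pi>' \<and> a = b"
proof -
  have "prod_encode (v, trace_code \<pi>) = prod_encode (v', trace_code \<pi>') \<and> a = b"
    using prefix_codeD[OF prefix_code_digits[OF assms(1)]] assms(2)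
    unfolding trace_digits_def by blast
  then show ?thesis using bij_trace_code by (auto dest: bij_is_inj injD)
qed

section \<open>Decoding by unbounded search\<close>

definition search_decode :: "(nat \<Rightarrow> nat) \<Rightarrow> bool list \<Rightarrow> trace option" where
  "search_decode idx w = (if \<exists>v \<pi>. trace_digits idx v \<pi> = map of_bool w
     then Some (THE \<pi>. \<exists>v. trace_digits idx v \<pi> = map of_bool w) else None)"

lemma search_decode_eq_Some:
  assumes "inj idx"
  shows "search_decode idx w = Some \<pi> \<longleftrightarrow> (\<exists>v. trace_digits idx v \<pi> = map of_bool w)"
proof -
  have unique: "\<pi>1 = \<pi>2" if "trace_digits idx v1 \<pi>1 = map of_bool w" "trace_digits idx v2 \<pi>2 = map of_bool w"
    for v1 v2 \<pi>1 \<pi>2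
    using trace_digits_cancel[OF assms, of v1 \<pi>1 "[]" v2 \<pi>2 "[]"] that by simp
  have "(THE \<pi>. \<exists>v. trace_digits idx v \<pi> = map of_bool w) = \<pi>"
    if "trace_digits idx v \<pi> = map of_bool w" for v \<pi>
    using that unique by blast
  then show ?thesis unfolding search_decode_def by (metis option.distinct(1) option.inject)
qed

lemma self_delimiting_search_decode:
  assumes "inj idx"
  shows "self_delimiting (search_decode idx)"
  unfolding self_delimiting_def
proof (intro allI impI, elim conjE)
  fix w w'
  assume "search_decode idx w \<noteq> None" "search_decode idx w' \<noteq> None" "prefix w w'"
  then obtain v \<pi> v' \<pi>' u where
    w: "trace_digits idx v \<pi> = map of_bool w" and w': "trace_digits idx v' \<pi>' = map of_bool w'"
    and u: "w' = w @ u"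
    using search_decode_eq_Some[OF assms] by (fastforce elim: prefixE)
  then have "trace_digits idx v \<pi> @ map of_bool u = trace_digits idx v' \<pi>' @ []" by simp
  then show "w = w'" using trace_digits_cancel[OF assms] u by blast
qed

text \<open>Minimisation looks for a number whose digits are the given word and diverges exactly
  when there is none; afterwards \<open>psnd\<close> discards the width.\<close>

lemma computable_search_decode:
  assumes inj: "inj idx" and idx: "computable 1 (\<lambda>xs. idx (xs ! 0))"
  shows "computable_decoder (search_decode idx)"
proof -
  \<comment> \<open>The sum of both truncated differences vanishes iff the two codes agree.\<close>
  have "computable 2 (\<lambda>ys. (list_encode (digits idx (ys ! 0)) - ys ! 1)
      + (ys ! 1 - list_encode (digits idx (ys ! 0))))"
    by (intro computable_add computable_diff computable_comp1[OF computable_digits[OF idx]]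
        computable_proj) simp_all
  then obtain f where f: "\<And>s b. rec_run f [s, b] =
      Some ((list_encode (digits idx s) - b) + (b - list_encode (digits idx s)))"
    unfolding computable_def 
    by (metis One_nat_def length_Cons list.size(3) nth_Cons_0 nth_Cons_Suc numeral_2_eq_2)
  obtain g where g: "\<And>s. rec_run g [s] = Some (psnd s)"
    using computable_psnd[OF computable_proj[OF zero_less_one]] unfolding computable_def
    by (metis One_nat_def length_Cons list.size(3) nth_Cons_0)
  have test: "rec_run f [s, bits_code w] = Some 0 \<longleftrightarrow> digits idx s = map of_bool w" for s w
    unfolding f bits_code_def by (auto simp flip: list_encode_eq)
  have pair: "digits idx s = trace_digits idx (pfst s) (inv trace_code (psnd s))" for s
    by (simp add: trace_digits_def prod_encode_pfst_psnd surj_f_inv_f[OF bij_is_surj[OF bij_trace_code]])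
  have "rec_run (Comp g [Mu f]) [bits_code w] = map_option trace_code (search_decode idx w)" for w
  proof (cases "search_decode idx w")
    case None
    then have "trace_digits idx v \<pi> \<noteq> map of_bool w" for v \<pi>
      using search_decode_eq_Some[OF inj, of w] by (metis option.distinct(1))
    then have "rec_run f [s, bits_code w] \<noteq> Some 0" for s
      unfolding test pair by blast
    then show ?thesis using None by simp
  next
    case (Some \<pi>)
    then obtain v where v: "trace_digits idx v \<pi> = map of_bool w"
      using search_decode_eq_Some[OF inj] by blast
    \<comment> \<open>By unique parsing the test has a single zero, so the least one is the intended
      pair.\<close>
    have only: "rec_run f [s, bits_code w] = Some 0 \<longleftrightarrow> s = prod_encode (v, trace_code \<pi>)" for s
      unfolding test v[symmetric] trace_digits_def
      using prefix_codeD[OF prefix_code_digits[OF inj], of s "[]" _ "[]"] by auto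
    have "\<forall>i. rec_run f [i, bits_code w] \<noteq> None" by (simp add: f)
    then have "rec_run (Mu f) [bits_code w] = Some (prod_encode (v, trace_code \<pi>))"
      by (simp add: only Least_equality)
    then show ?thesis using Some g by (simp del: rec_run.simps(6))
  qed
  then show ?thesis unfolding computable_decoder_def by blast
qed

section \<open>Length of the code\<close>

lemma set_low_digits: "set (low_digits v x) \<subseteq> {0, 1}"
  by (induction v) auto

lemma set_block: "x < 2 ^ Suc v \<Longrightarrow> set (block v x) \<subseteq> {0, 1}"
  using set_low_digits[of v x] less_mult_imp_div_less[of x 2 "2 ^ v"]
  by (auto simp: block_def less_2_cases_iff)

lemma set_unary: "set (unary v) \<subseteq> {0, 1}"
  by (auto simp: unary_def)

lemma set_list_code: "(\<And>x. x \<in> set xs \<Longrightarrow> set (f x) \<subseteq> {0, 1}) \<Longrightarrow> set (list_code f xs) \<subseteq> {0, 1}"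
  by (induction xs) auto

text \<open>Each entry costs its continuation digit on top of \<open>l\<close>; the closing 0 is the
  final 1.\<close>

lemma length_list_code_le:
  "(\<And>x. x \<in> set xs \<Longrightarrow> length (f x) \<le> l) \<Longrightarrow> length (list_code f xs) \<le> length xs * Suc l + 1"
proof (induction xs)
  case (Cons x xs)
  have "length (f x) \<le> l" "length (list_code f xs) \<le> length xs * Suc l + 1"
    using Cons by auto
  then show ?case by simp
qed simp

section \<open>Sizes of pointers and rule indices\<close>

text \<open>A step enlarges the pool by one and shortens the remaining list by one, so the sum of
  both lengths is invariant and bounds every pointer. The formulas \<open>fs\<close> only record
  that the rule applies to as many premises as there are pointers.\<close>

lemma run_steps_bounds:
  assumes "run_steps P ss pool = Some pool'"
  shows "length pool' = length pool + length ss"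
    and "(r, ps) \<in> set ss \<Longrightarrow> r \<in> rules P \<and> (\<exists>fs c. length fs = length ps \<and> concl P r fs = Some c) \<and>
      (\<forall>p\<in>set ps. p < length pool + length ss)"
proof -
  have "length pool' = length pool + length ss \<and>
    (\<forall>(r, ps)\<in>set ss. r \<in> rules P \<and> (\<exists>fs c. length fs = length ps \<and> concl P r fs = Some c) \<and>
      (\<forall>p\<in>set ps. p < length pool + length ss))"
    using assms
  proof (induction ss arbitrary: pool)
    case (Cons s ss)
    obtain r ps where s: "s = (r, ps)" by fastforce
    with Cons.prems obtain c where
      c: "r \<in> rules P" "\<forall>p\<in>set ps. p < length pool" "concl P r (map (\<lambda>p. pool ! p) ps) = Some c"
        "run_steps P ss (pool @ [c]) = Some pool'"
      by (auto simp: bind_eq_Some_conv split: if_splits)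
    have "\<exists>fs c. length fs = length ps \<and> concl P r fs = Some c"
      using c(3) by (metis length_map)
    with Cons.IH[OF c(4)] c(1,2) s show ?case by fastforce
  qed simp
  then show "length pool' = length pool + length ss"
    and "(r, ps) \<in> set ss \<Longrightarrow> r \<in> rules P \<and> (\<exists>fs c. length fs = length ps \<and> concl P r fs = Some c) \<and>
      (\<forall>p\<in>set ps. p < length pool + length ss)"
    by auto
qed

lemma derivation_trace_bounds:
  assumes P: "effective_proof_system P" and d: "derivation_trace P B q (ss, j)"
  shows "j < card B + length ss"
    and "(r, ps) \<in> set ss \<Longrightarrow> r \<in> rules P \<and> length ps = arity P r \<and>
      (\<forall>p\<in>set ps. p < card B + length ss)"
proof -
  obtain pool where B: "premise_base P B" and pool: "run_steps P ss (canon P B) = Some pool"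
    and j: "j < length pool"
    using d by (auto simp: derivation_trace_def replay_def bind_eq_Some_conv split: if_splits)
  have "set (canon P B) = B" "distinct (canon P B)"
    using P B unfolding effective_proof_system_def canonical_listing_def by blast+
  then have card: "length (canon P B) = card B" using distinct_card by metis
  show "j < card B + length ss" using j run_steps_bounds(1)[OF pool] card by simp
  have arity: "length fs = arity P r" if "r \<in> rules P" "concl P r fs = Some c" for r fs c
    using P that unfolding effective_proof_system_def by blast
  show "r \<in> rules P \<and> length ps = arity P r \<and> (\<forall>p\<in>set ps. p < card B + length ss)"
    if "(r, ps) \<in> set ss"
    using run_steps_bounds(2)[OF pool that] arity card by metis
qed

text \<open>Rule identifiers may be arbitrarily large, so they are renumbered below
  \<open>card R\<close> to keep their unary codes short. Shifting the other numbers by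
  \<open>card R\<close> keeps the index injective everywhere, which unique parsing over all numbers
  requires.\<close>

lemma ex_computable_rule_index:
  fixes R :: "nat set"
  assumes "finite R"
  obtains idx where "inj idx" "\<And>r. r \<in> R \<Longrightarrow> idx r < card R" "computable 1 (\<lambda>xs. idx (xs ! 0))"
proof -
  obtain h where h: "bij_betw h R {0..<card R}"
    using ex_bij_betw_finite_nat[OF assms] by blast
  let ?idx = "\<lambda>r. if r \<in> R then h r else r + card R"
  have lt: "h r < card R" if "r \<in> R" for r
    using bij_betwE[OF h] that by auto
  have "inj ?idx"
  proof (rule injI)
    fix x y
    assume "?idx x = ?idx y"
    then show "x = y"
      using lt[of x] lt[of y] inj_on_eq_iff[OF bij_betw_imp_inj_on[OF h], of x y]
      by (simp split: if_splits)
  qed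
  moreover have "computable 1 (\<lambda>xs. ?idx (xs ! 0))"
    by (intro computable_finite_cases[OF assms, of "\<lambda>r. r + card R"] computable_add computable_proj
        computable_const) simp
  ultimately show ?thesis using that[of ?idx] lt by simp
qed

text \<open>The encoder is not told the size of the premise base, so the width is minimised over the trace
  alone.\<close>

definition width :: "(nat \<Rightarrow> nat) \<Rightarrow> trace \<Rightarrow> nat" where
  "width idx \<pi> = (LEAST v. set (trace_digits idx v \<pi>) \<subseteq> {0, 1})"

definition trace_bits :: "(nat \<Rightarrow> nat) \<Rightarrow> trace \<Rightarrow> bool list" where
  "trace_bits idx \<pi> = map (\<lambda>d. d = 1) (trace_digits idx (width idx \<pi>) \<pi>)"

lemma trace_digits_binary:
  assumes "j < 2 ^ Suc v" "\<And>r ps p. (r, ps) \<in> set ss \<Longrightarrow> p \<in> set ps \<Longrightarrow> p < 2 ^ Suc v"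
  shows "set (trace_digits idx v (ss, j)) \<subseteq> {0, 1}"
proof -
  have "set (list_code (\<lambda>(r, ps). unary (idx r) @ list_code (block v) ps) ss) \<subseteq> {0, 1}"
  proof (rule set_list_code)
    fix s
    assume "s \<in> set ss"
    then obtain r ps where s: "s = (r, ps)" and rps: "(r, ps) \<in> set ss" by (metis surj_pair)
    have "set (list_code (block v) ps) \<subseteq> {0, 1}"
      by (intro set_list_code set_block assms(2)[OF rps])
    then show "set (case s of (r, ps) \<Rightarrow> unary (idx r) @ list_code (block v) ps) \<subseteq> {0, 1}"
      using set_unary[of "idx r"] s by simp
  qed
  then show ?thesis
    unfolding trace_digits_eq using set_unary[of v] set_block[OF assms(1)] by simp
qed

text \<open>The unary width and the output block take \<open>v + 1\<close> digits each and the end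
  of the step list one. A step takes a continuation digit, at most \<open>c\<close> digits for its
  rule, and at most \<open>k\<close> blocks with their continuation digits and one
  terminator.\<close>

lemma length_trace_digits_le:
  assumes "\<And>r ps. (r, ps) \<in> set ss \<Longrightarrow> idx r < c \<and> length ps \<le> k"
  shows "length (trace_digits idx v (ss, j)) \<le> 2 * v + 3 + length ss * (k * (v + 2) + c + 2)"
proof -
  let ?f = "\<lambda>(r, ps). unary (idx r) @ list_code (block v) ps"
  have "length (list_code ?f ss) \<le> length ss * Suc (c + (k * (v + 2) + 1)) + 1"
  proof (rule length_list_code_le)
    fix s
    assume "s \<in> set ss"
    moreover obtain r ps where s: "s = (r, ps)" by fastforce
    ultimately have r: "idx r < c" "length ps \<le> k" using assms by auto
    have "length (list_code (block v) ps) \<le> length ps * (v + 2) + 1"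
      using length_list_code_le[of ps "block v" "Suc v"] by simp
    also have "\<dots> \<le> k * (v + 2) + 1" using r(2) by (intro add_right_mono mult_right_mono) auto
    finally show "length (?f s) \<le> c + (k * (v + 2) + 1)"
      using r(1) s by (simp add: unary_def)
  qed
  then show ?thesis by (simp add: trace_digits_eq unary_def algebra_simps)
qed

section \<open>The encoding and its length bound\<close>

theorem mainTheorem9:
  shows "\<exists>(c :: nat \<Rightarrow> nat \<Rightarrow> real) (c' :: real). \<forall>(P :: proof_system) (k :: nat).
    effective_proof_system P \<longrightarrow> finite (rules P) \<longrightarrow> (\<forall>r\<in>rules P. arity P r \<le> k) \<longrightarrow>
    (\<exists>enc. trace_encoding P enc \<and>
      (\<forall>B q \<pi> m n. derivation_trace P B q \<pi> \<longrightarrow> m = card B \<longrightarrow> n = trace_length \<pi> \<longrightarrow>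
        real (length (enc \<pi>)) \<le>
          real k * real n * log 2 (real (m + n + 1))
          + c (card (rules P)) k * real n
          + c' * log 2 (real (m + n + 1))))"
proof (rule exI[of _ "\<lambda>R k. real (2 * k + R + 2)"], rule exI[of _ 5], intro allI impI)
  \<comment> \<open>With \<open>L\<close> the logarithm in the bound and a width of at most
    \<open>L\<close>, a step costs at most \<open>k * (L + 2) + R + 2\<close> digits, which leaves
    \<open>2 * k + R + 2\<close> beside \<open>k * L\<close>. The overhead of twice the width plus 3
    is at most \<open>5 * L\<close>.\<close>
  fix P :: proof_system and k :: nat
  assume P: "effective_proof_system P" and fin: "finite (rules P)"
    and k: "\<forall>r\<in>rules P. arity P r \<le> k"
  obtain idx where inj: "inj idx" and idx: "\<And>r. r \<in> rules P \<Longrightarrow> idx r < card (rules P)"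
    and comp: "computable 1 (\<lambda>xs. idx (xs ! 0))"
    using ex_computable_rule_index[OF fin] by blast
  have binary: "set (trace_digits idx v \<pi>) \<subseteq> {0, 1}"
    if d: "derivation_trace P B q \<pi>" and v: "card B + trace_length \<pi> \<le> 2 ^ Suc v" for B q \<pi> v
  proof -
    obtain ss j where \<pi>: "\<pi> = (ss, j)" by fastforce
    note b = derivation_trace_bounds[OF P d[unfolded \<pi>]]
    have v': "card B + length ss \<le> 2 ^ Suc v" using v \<pi> by (simp add: trace_length_def)
    show ?thesis unfolding \<pi>
    proof (rule trace_digits_binary)
      show "j < 2 ^ Suc v" using b(1) v' by linarith
      show "p < 2 ^ Suc v" if "(r, ps) \<in> set ss" "p \<in> set ps" for r ps p
        using b(2)[OF that(1)] that(2) v' by (meson order_less_le_trans)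
    qed
  qed
  have "search_decode idx (trace_bits idx \<pi>) = Some \<pi>" if d: "derivation_trace P B q \<pi>" for B q \<pi>
  proof -
    \<comment> \<open>A wasteful width, which only shows that the minimum defining
      \<open>width\<close> exists.\<close>
    have "card B + trace_length \<pi> \<le> 2 ^ Suc (card B + trace_length \<pi>)"
      by (meson less_exp less_imp_le order_trans power_increasing lessI one_le_numeral)
    then have "set (trace_digits idx (width idx \<pi>) \<pi>) \<subseteq> {0, 1}"
      unfolding width_def by (intro LeastI[of "\<lambda>v. set (trace_digits idx v \<pi>) \<subseteq> {0, 1}"] binary[OF d])
    then have "trace_digits idx (width idx \<pi>) \<pi> = map of_bool (trace_bits idx \<pi>)"
      unfolding trace_bits_def map_map by (intro map_idI[symmetric]) auto
    then show ?thesis using search_decode_eq_Some[OF inj] by blast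
  qed
  then have "trace_encoding P (trace_bits idx)"
    unfolding trace_encoding_def
    using computable_search_decode[OF inj comp] self_delimiting_search_decode[OF inj] by blast
  moreover have "real (length (trace_bits idx \<pi>)) \<le>
          real k * real n * log 2 (real (m + n + 1))
          + real (2 * k + card (rules P) + 2) * real n
          + 5 * log 2 (real (m + n + 1))"
    if d: "derivation_trace P B q \<pi>" and m: "m = card B" and n: "n = trace_length \<pi>" for B q \<pi> m n
  proof -
    obtain ss j where \<pi>: "\<pi> = (ss, j)" by fastforce
    note b = derivation_trace_bounds[OF P d[unfolded \<pi>]]
    have n': "n = length ss" using n \<pi> by (simp add: trace_length_def)
    \<comment> \<open>The output pointer lies in the pool, so the pool is nonempty; hence
      \<open>L\<close> is at least 1 and absorbs the additive constant.\<close>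
    have pos: "m + n > 0" using b(1) m n' by linarith
    define L where "L = log 2 (real (m + n + 1))"
    have "2 \<le> real (m + n + 1)" using pos by linarith
    then have L1: "1 \<le> L" unfolding L_def by (simp add: le_log_iff)
    \<comment> \<open>This \<open>v\<close> is the rounded-down logarithm of \<open>m + n\<close>.
      Blocks have \<open>v + 1\<close> digits, so it is wide enough for all pointers and still at
      most \<open>L\<close>.\<close>
    obtain v where v: "2 ^ v \<le> m + n" "m + n < 2 ^ Suc v"
      using ex_power_ivl1[of 2 "m + n"] pos by auto
    have "real v \<le> L"
    proof -
      have "2 ^ v \<le> real (m + n + 1)" using v(1) by (metis le_add1 of_nat_le_iff of_nat_numeral of_nat_power order_trans)
      then show ?thesis unfolding L_def using pos by (simp add: le_log_iff powr_realpow)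
    qed
    \<comment> \<open>The width is minimal for the trace alone, so a width obtained from the size of
      the base bounds it although the encoder never sees that size.\<close>
    moreover have "width idx \<pi> \<le> v"
      unfolding width_def using v(2) m n by (intro Least_le binary[OF d]) simp
    ultimately have w: "real (width idx \<pi>) \<le> L" by linarith
    have "length (trace_bits idx \<pi>) \<le>
        2 * width idx \<pi> + 3 + n * (k * (width idx \<pi> + 2) + card (rules P) + 2)"
      unfolding trace_bits_def length_map n' \<pi>
      by (rule length_trace_digits_le) (use b(2) idx k in fastforce)
    then have "real (length (trace_bits idx \<pi>)) \<le>
        2 * real (width idx \<pi>) + 3 + real n * (real k * (real (width idx \<pi>) + 2) + real (card (rules P)) + 2)"
      by (metis (mono_tags, lifting) of_nat_le_iff of_nat_add of_nat_mult of_nat_numeral)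
    also have "\<dots> \<le> 2 * L + 3 * L + real n * (real k * (L + 2) + real (card (rules P)) + 2)"
      using w L1 by (intro add_mono mult_left_mono) auto
    finally show ?thesis unfolding L_def[symmetric] by (simp add: algebra_simps)
  qed
  ultimately show "\<exists>enc. trace_encoding P enc \<and>
      (\<forall>B q \<pi> m n. derivation_trace P B q \<pi> \<longrightarrow> m = card B \<longrightarrow> n = trace_length \<pi> \<longrightarrow>
        real (length (enc \<pi>)) \<le>
          real k * real n * log 2 (real (m + n + 1))
          + real (2 * k + card (rules P) + 2) * real n
          + 5 * log 2 (real (m + n + 1)))"
    by blast
qed

end
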